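(* With the notation of the context, for every $a\in(0,\tfrac12)$, writing $s_1=s_1(a)$ and $z=z_a(s_1)$, $$R'(a)=\frac{\tfrac12\sin(2s_1)+2a\bigl(z^2\cos(2s_1)+a\sin^2(2s_1)\bigr)\,s_1'(a)}{z^4+a^2\sin^2(2s_1)},$$ whose denominator is strictly positive, and $$s_1'(a)=-\,\frac{z_a(s_1)}{y_a(s_1)}\,\bigl(\partial_aG_a\bigr)(s_1).$$ In particular $a$ is a critical point of $R$ if and only if $$\tfrac12\sin(2s_1)+2a\bigl(z^2\cos(2s_1)+a\sin^2(2s_1)\bigr)\,s_1'(a)=0 .$$
   Context: For $a\in(0,\tfrac12)$ put $\lambda_a(s)=\tfrac12-a\cos 2s$, $z_a(s)=(\tfrac12+a\cos2s)^{1/2}$, $c(a)=(\tfrac14-a^2)^{1/2}$, $\omega(a,t)=\dfrac{c(a)}{z_a(t)\lambda_a(t)}$, $\beta(a,s)=\int_0^s\omega(a,t)\,dt$, $x_a=\lambda_a^{1/2}\cos\beta(a,\cdot)$, $y_a=\lambda_a^{1/2}\sin\beta(a,\cdot)$, and $G_a=y_a\dot z_a-z_a\dot y_a$, where a dot denotes $d/ds$. $G_a$ has exactly one zero in $(0,\tfrac\pi2]$, denoted $s_1(a)$, and $R(a)=\arccos x_a(s_1(a))\in(0,\pi)$. The functions $s_1$ and $R$ are real-analytic on $(0,\tfrac12)$. $(\partial_aG_a)(s_1)$ is the derivative of $G_a(s)$ in $a$ at fixed $s$, evaluated at $s=s_1(a)$. *)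

theory Defs
  imports "HOL-Analysis.Analysis"
begin

(* All functions are used for 0 < a < 1/2 only; there lam_fn a s > 0 and
   1/2 + a cos 2s > 0 for every real s, so all square roots and quotients
   below are the genuine ones. *)

definition lam_fn :: "real \<Rightarrow> real \<Rightarrow> real" where
  "lam_fn a s = 1/2 - a * cos (2 * s)"

definition z_fn :: "real \<Rightarrow> real \<Rightarrow> real" where
  "z_fn a s = sqrt (1/2 + a * cos (2 * s))"

definition c_fn :: "real \<Rightarrow> real" where
  "c_fn a = sqrt (1/4 - a\<^sup>2)"

definition omega_fn :: "real \<Rightarrow> real \<Rightarrow> real" where
  "omega_fn a t = c_fn a / (z_fn a t * lam_fn a t)"

(* oriented integral, hence also correct for s < 0 *)
definition beta_fn :: "real \<Rightarrow> real \<Rightarrow> real" where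
  "beta_fn a s = (LBINT t=0..s. omega_fn a t)"

definition x_fn :: "real \<Rightarrow> real \<Rightarrow> real" where
  "x_fn a s = sqrt (lam_fn a s) * cos (beta_fn a s)"

definition y_fn :: "real \<Rightarrow> real \<Rightarrow> real" where
  "y_fn a s = sqrt (lam_fn a s) * sin (beta_fn a s)"

definition G_fn :: "real \<Rightarrow> real \<Rightarrow> real" where
  "G_fn a s = y_fn a s * deriv (z_fn a) s - z_fn a s * deriv (y_fn a) s"

(* for 0 < a < 1/2 there is exactly one such zero *)
definition s1_fn :: "real \<Rightarrow> real" where
  "s1_fn a = (THE s. 0 < s \<and> s \<le> pi / 2 \<and> G_fn a s = 0)"

definition R_fn :: "real \<Rightarrow> real" where
  "R_fn a = arccos (x_fn a (s1_fn a))"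

end

theory Submission
  imports Defs
begin

text \<open>
  The curve \<open>(x_fn a, y_fn a, z_fn a)\<close> has unit speed and lies on the unit sphere, and
  \<open>G_fn a\<close> is the first component of its normal field (position times velocity). Writing
  \<open>d = z\<^sup>2 - c\<^sup>2\<close>, which is also \<open>z ^ 4 + a\<^sup>2 sin\<^sup>2 2s\<close>, one can put \<open>G_fn a\<close> in polar form:
  it equals \<open>sqrt d / z\<close> times the sine of a phase
  \<open>\<Phi> = \<beta> - \<pi>/2 - arctan (a sin 2s / (c z))\<close> (\<open>G_eq_sin_phase\<close>). The reason for passing to
  the phase is that all terms but one cancel in its derivative, leaving
  \<open>\<Phi>' = c z / d > 0\<close> (\<open>phase_deriv\<close>).

  The phase increases from \<open>-\<pi>/2\<close> at \<open>0\<close> to a value in \<open>]0, \<pi>/4]\<close> at \<open>\<pi>/2\<close>.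
  The bounds come from comparing \<open>c z / d\<close> with \<open>c\<^sup>2 / d\<close>, which has an elementary
  antiderivative (\<open>phase_half_pi\<close>). Hence the zero of \<open>G_fn a\<close> in \<open>]0, \<pi>/2]\<close> is the
  unique zero of \<open>\<Phi>\<close>, and it lies in the open interval.

  The derivative of \<open>s1\<close> is that of an implicit function: minus the parameter
  derivative of \<open>\<Phi>\<close> divided by \<open>c z / d\<close> (\<open>s1_deriv\<close>). Where \<open>\<Phi>\<close> vanishes, the parameter
  derivative of \<open>G_fn\<close> is \<open>sqrt d / z\<close> times that of \<open>\<Phi>\<close> (\<open>G_param_deriv_at_s1\<close>), and
  \<open>y = c z / sqrt d\<close> (\<open>y_s1\<close>); together these give the quotient \<open>- z / y\<close>.

  At the zero, the equation \<open>\<Phi> = 0\<close> expresses the non-elementary angle \<open>\<beta>\<close>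
  through elementary functions, which leads to
  \<open>R = \<pi>/2 + arctan (a sin (2 s1) / z\<^sup>2)\<close> (\<open>R_eq_arctan\<close>). No integral is left in this
  formula, and the chain rule gives the claim with \<open>d\<close> as the denominator.
\<close>

section \<open>The curve and its elementary identities\<close>

definition d_fn :: "real \<Rightarrow> real \<Rightarrow> real" where
  "d_fn a s = (z_fn a s)\<^sup>2 - (c_fn a)\<^sup>2"

definition phase_fn :: "real \<Rightarrow> real \<Rightarrow> real" where
  "phase_fn a s = beta_fn a s - pi / 2 - arctan (a * sin (2 * s) / (c_fn a * z_fn a s))"

lemma abs_mult_cos_less_half:
  fixes a s :: real
  assumes "0 < a" "a < 1/2"
  shows "\<bar>a * cos s\<bar> < 1/2"
proof -
  have "a * \<bar>cos s\<bar> \<le> a * 1"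
    using assms by (intro mult_left_mono) auto
  with assms show ?thesis
    unfolding abs_mult by linarith
qed

lemma lam_pos: "0 < a \<Longrightarrow> a < 1/2 \<Longrightarrow> 0 < lam_fn a s"
  using abs_mult_cos_less_half[of a "2 * s"] by (simp add: lam_fn_def)

lemma radicand_pos: "0 < a \<Longrightarrow> a < 1/2 \<Longrightarrow> 0 < 1/2 + a * cos (2 * s)"
  for a :: real
  using abs_mult_cos_less_half[of a "2 * s"] by simp

lemma z_pos: "0 < a \<Longrightarrow> a < 1/2 \<Longrightarrow> 0 < z_fn a s"
  using radicand_pos by (simp add: z_fn_def)

lemma z_squared: "0 < a \<Longrightarrow> a < 1/2 \<Longrightarrow> (z_fn a s)\<^sup>2 = 1/2 + a * cos (2 * s)"
  using radicand_pos[of a s] by (simp add: z_fn_def)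

lemma lam_eq: "0 < a \<Longrightarrow> a < 1/2 \<Longrightarrow> lam_fn a s = 1 - (z_fn a s)\<^sup>2"
  by (simp add: z_squared lam_fn_def)

lemma quarter_minus_square_pos: "0 < a \<Longrightarrow> a < 1/2 \<Longrightarrow> 0 < 1/4 - a\<^sup>2"
  for a :: real
  using power_strict_mono[of a "1/2" 2] by (simp add: power2_eq_square)

lemma c_pos: "0 < a \<Longrightarrow> a < 1/2 \<Longrightarrow> 0 < c_fn a"
  using quarter_minus_square_pos by (simp add: c_fn_def)

lemma c_squared: "0 < a \<Longrightarrow> a < 1/2 \<Longrightarrow> (c_fn a)\<^sup>2 = 1/4 - a\<^sup>2"
  using quarter_minus_square_pos[of a] by (simp add: c_fn_def)

text \<open>
  The speed of the curve is 1: its square is the left-hand side divided by \<open>\<lambda> z\<^sup>2\<close>. The two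
  formulas for denominators below rest on this identity.
\<close>

lemma unit_speed:
  assumes "0 < a" "a < 1/2"
  shows "(c_fn a)\<^sup>2 + a\<^sup>2 * (sin (2 * s))\<^sup>2 = lam_fn a s * (z_fn a s)\<^sup>2"
  unfolding c_squared[OF assms] z_squared[OF assms] lam_fn_def sin_squared_eq
  by (simp add: power2_eq_square algebra_simps)

text \<open>By \<open>cos \<ge> -1\<close>, the difference is at least \<open>(1/2 - a)\<^sup>2\<close>.\<close>

lemma d_pos:
  assumes "0 < a" "a < 1/2"
  shows "0 < d_fn a s"
proof -
  have "-a * 1 \<le> a * cos (2 * s)"
    using mult_left_mono[of "-1" "cos (2 * s)" a] assms by simp
  moreover have "0 < (1/2 - a)\<^sup>2"
    using assms by simp
  ultimately show ?thesis
    unfolding d_fn_def z_squared[OF assms] c_squared[OF assms]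
    by (simp add: power2_eq_square algebra_simps)
qed

lemma denominator_eq:
  assumes "0 < a" "a < 1/2"
  shows "z_fn a s ^ 4 + a\<^sup>2 * (sin (2 * s))\<^sup>2 = d_fn a s"
proof -
  have "z_fn a s ^ 4 = (z_fn a s)\<^sup>2 * (z_fn a s)\<^sup>2"
    by (simp flip: power_add)
  moreover have "a\<^sup>2 * (sin (2 * s))\<^sup>2 = (1 - (z_fn a s)\<^sup>2) * (z_fn a s)\<^sup>2 - (c_fn a)\<^sup>2"
    using unit_speed[OF assms, of s] unfolding lam_eq[OF assms] by linarith
  ultimately show ?thesis
    unfolding d_fn_def by (simp only:) (simp add: algebra_simps)
qed

lemma mixed_denominator_eq:
  assumes "0 < a" "a < 1/2"
  shows "(c_fn a)\<^sup>2 * (z_fn a s)\<^sup>2 + a\<^sup>2 * (sin (2 * s))\<^sup>2 = lam_fn a s * d_fn a s"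
proof -
  have "a\<^sup>2 * (sin (2 * s))\<^sup>2 = (1 - (z_fn a s)\<^sup>2) * (z_fn a s)\<^sup>2 - (c_fn a)\<^sup>2"
    using unit_speed[OF assms, of s] unfolding lam_eq[OF assms] by linarith
  then show ?thesis
    unfolding d_fn_def lam_eq[OF assms] by (simp only:) (simp add: algebra_simps)
qed

section \<open>Derivatives along the curve\<close>

lemma z_deriv:
  assumes "0 < a" "a < 1/2"
  shows "(z_fn a has_real_derivative - (a * sin (2 * s)) / z_fn a s) (at s)"
  unfolding z_fn_def
  using radicand_pos[OF assms, of s]
  by (auto intro!: derivative_eq_intros simp: field_simps)

text \<open>
  The integration interval of the fundamental theorem is \<open>{-m..m}\<close> with \<open>m = \<bar>s\<bar> + 1\<close>, so that \<open>0\<close>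
  and \<open>s\<close> are interior points and the derivative is two-sided.
\<close>

lemma beta_deriv:
  assumes "0 < a" "a < 1/2"
  shows "(beta_fn a has_real_derivative omega_fn a s) (at s)"
proof -
  define m where "m = \<bar>s\<bar> + 1"
  have "continuous_on {-m..m} (omega_fn a)"
    using z_pos[OF assms] lam_pos[OF assms]
    unfolding omega_fn_def z_fn_def lam_fn_def
    by (intro continuous_intros) (auto simp: less_imp_neq[symmetric])
  then have "((\<lambda>u. LBINT y=0..u. omega_fn a y) has_vector_derivative omega_fn a s) (at s within {-m..m})"
    unfolding zero_ereal_def by (intro interval_integral_FTC2) (auto simp: m_def)
  moreover have "at s within {-m..m} = at s"
    by (rule at_within_interior) (auto simp: m_def)
  ultimately show ?thesis
    by (simp add: beta_fn_def[abs_def] has_real_derivative_iff_has_vector_derivative)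
qed

lemma lam_deriv: "(lam_fn a has_real_derivative 2 * a * sin (2 * s)) (at s)"
  unfolding lam_fn_def by (auto intro!: derivative_eq_intros)

lemma y_deriv:
  assumes "0 < a" "a < 1/2"
  shows "(y_fn a has_real_derivative
     a * sin (2 * s) / sqrt (lam_fn a s) * sin (beta_fn a s)
     + c_fn a / (z_fn a s * sqrt (lam_fn a s)) * cos (beta_fn a s)) (at s)"
proof -
  have "sqrt (lam_fn a s) * sqrt (lam_fn a s) = lam_fn a s"
    using lam_pos[OF assms, of s] by simp
  then have "sqrt (lam_fn a s) / lam_fn a s = 1 / sqrt (lam_fn a s)"
    using lam_pos[OF assms, of s] by (simp add: field_simps)
  then show ?thesis
    unfolding y_fn_def
    using lam_pos[OF assms, of s] z_pos[OF assms, of s]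
    by (auto intro!: derivative_eq_intros lam_deriv beta_deriv[OF assms]
        simp: omega_fn_def field_simps)
qed

section \<open>The phase of the normal component\<close>

text \<open>
  For the argument \<open>u\<close> of \<open>arctan\<close> in the phase, \<open>sqrt (1 + u\<^sup>2)\<close> is the denominator of
  \<open>sin (arctan u)\<close> and \<open>cos (arctan u)\<close>.
\<close>

lemma sqrt_one_plus_square:
  assumes "0 < a" "a < 1/2"
  shows "sqrt (1 + (a * sin (2 * s) / (c_fn a * z_fn a s))\<^sup>2)
    = sqrt (lam_fn a s) * sqrt (d_fn a s) / (c_fn a * z_fn a s)"
proof -
  note pos = c_pos[OF assms] z_pos[OF assms, of s]
  have "1 + (a * sin (2 * s) / (c_fn a * z_fn a s))\<^sup>2 = lam_fn a s * d_fn a s / (c_fn a * z_fn a s)\<^sup>2"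
    using pos unfolding mixed_denominator_eq[OF assms, symmetric] by (simp add: field_simps)
  then show ?thesis
    using pos by (simp add: real_sqrt_divide real_sqrt_mult)
qed

text \<open>
  Inserting the derivatives of \<open>y\<close> and \<open>z\<close> and \<open>\<lambda> + z\<^sup>2 = 1\<close> gives
  \<open>G = - (c cos \<beta> + (a sin 2s / z) sin \<beta>) / sqrt \<lambda>\<close>, a combination of \<open>cos \<beta>\<close> and \<open>sin \<beta>\<close>
  whose coefficient vector has direction \<open>arctan (a sin 2s / (c z))\<close>. Subtracting this
  direction and a right angle from \<open>\<beta>\<close> leaves a single sine.
\<close>

lemma G_eq_sin_phase:
  assumes "0 < a" "a < 1/2"
  shows "G_fn a s = sqrt (d_fn a s) / z_fn a s * sin (phase_fn a s)"
proof -
  define L where "L = sqrt (lam_fn a s)"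
  define \<beta> where "\<beta> = beta_fn a s"
  define S where "S = a * sin (2 * s)"
  define z where "z = z_fn a s"
  define c where "c = c_fn a"
  define q where "q = sqrt (d_fn a s)"
  have pos: "L > 0" "z > 0" "c > 0" "q > 0"
    using lam_pos[OF assms] z_pos[OF assms] c_pos[OF assms] d_pos[OF assms]
    by (auto simp: L_def z_def c_def q_def)
  have Lz: "L * L = 1 - z * z"
    using lam_pos[OF assms, of s] lam_eq[OF assms, of s]
    by (simp add: L_def z_def power2_eq_square)
  have root: "sqrt (1 + (S / (c * z))\<^sup>2) = L * q / (c * z)"
    using sqrt_one_plus_square[OF assms, of s] by (simp add: L_def z_def c_def q_def S_def)
  have "phase_fn a s = (\<beta> - arctan (S / (c * z))) - pi / 2"
    by (simp add: phase_fn_def \<beta>_def S_def c_def z_def)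
  then have "sin (phase_fn a s) = - cos (\<beta> - arctan (S / (c * z)))"
    by (simp add: sin_diff)
  also have "\<dots> = - (c * z * cos \<beta> + S * sin \<beta>) / (L * q)"
    unfolding cos_diff sin_arctan cos_arctan root using pos by (simp add: field_simps)
  finally have "q / z * sin (phase_fn a s) = - (c * cos \<beta> + S / z * sin \<beta>) / L"
    using pos by (simp add: field_simps)
  moreover have "G_fn a s = L * sin \<beta> * (- S / z) - z * (S / L * sin \<beta> + c / (z * L) * cos \<beta>)"
    unfolding G_fn_def DERIV_imp_deriv[OF z_deriv[OF assms]] DERIV_imp_deriv[OF y_deriv[OF assms]]
    by (simp add: y_fn_def L_def \<beta>_def S_def z_def c_def)
  moreover have "\<dots> = - (c * cos \<beta> + (L * L + z * z) * S / z * sin \<beta>) / L"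
    using pos by (simp add: field_simps)
  ultimately show ?thesis
    using Lz by (simp add: q_def z_def)
qed

text \<open>
  The derivative of \<open>\<beta>\<close> is \<open>c / (z \<lambda>)\<close>, and the derivative of the arctangent has denominator
  \<open>\<lambda> d z\<close>. In the difference the numerator collapses to \<open>c \<lambda> z\<^sup>2\<close> by \<open>unit_speed\<close>.
\<close>

lemma phase_deriv:
  assumes "0 < a" "a < 1/2"
  shows "(phase_fn a has_real_derivative c_fn a * z_fn a s / d_fn a s) (at s)"
proof -
  define z where "z = z_fn a s"
  define c where "c = c_fn a"
  define d where "d = d_fn a s"
  define l where "l = lam_fn a s"
  define S where "S = a * sin (2 * s)"
  have pos: "l > 0" "z > 0" "c > 0" "d > 0"
    using lam_pos[OF assms] z_pos[OF assms] c_pos[OF assms] d_pos[OF assms]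
    by (auto simp: l_def z_def c_def d_def)
  have S2: "S\<^sup>2 = l * z\<^sup>2 - c\<^sup>2" "1 + (S / (c * z))\<^sup>2 = l * d / (c * z)\<^sup>2"
    using unit_speed[OF assms, of s] mixed_denominator_eq[OF assms, of s] pos
    by (simp_all add: S_def l_def z_def c_def d_def field_simps)
  have C: "2 * (a * cos (2 * s)) = 1 - 2 * l"
    by (simp add: l_def lam_fn_def)
  have d: "d = z\<^sup>2 - c\<^sup>2"
    by (simp add: d_def d_fn_def z_def c_def)
  have quotient: "((\<lambda>s. a * sin (2 * s) / (c * z_fn a s)) has_real_derivative
      (2 * (a * cos (2 * s)) * (c * z) - S * (c * (- S / z))) / (c * z)\<^sup>2) (at s)"
    using pos by (auto intro!: derivative_eq_intros z_deriv[OF assms]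
        simp: z_def S_def power2_eq_square field_simps)
  have "(phase_fn a has_real_derivative omega_fn a s - inverse (1 + (S / (c * z))\<^sup>2) *
      ((2 * (a * cos (2 * s)) * (c * z) - S * (c * (- S / z))) / (c * z)\<^sup>2)) (at s)"
    using DERIV_diff[OF DERIV_diff[OF beta_deriv[OF assms, of s] DERIV_const[of "pi / 2"]]
        DERIV_chain2[OF DERIV_arctan quotient]]
    by (simp add: phase_fn_def[abs_def] z_def c_def S_def)
  moreover have "omega_fn a s - inverse (1 + (S / (c * z))\<^sup>2) *
      ((2 * (a * cos (2 * s)) * (c * z) - S * (c * (- S / z))) / (c * z)\<^sup>2)
    = c / (z * l) - c * ((1 - 2 * l) * z\<^sup>2 + S\<^sup>2) / (l * d * z)"
    unfolding S2(2) C using pos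
    by (simp add: omega_fn_def z_def[symmetric] c_def[symmetric] l_def[symmetric] field_simps power2_eq_square)
  moreover have "\<dots> = c * (d - (1 - 2 * l) * z\<^sup>2 - S\<^sup>2) / (l * d * z)"
    using pos by (simp add: field_simps)
  moreover have "d - (1 - 2 * l) * z\<^sup>2 - S\<^sup>2 = l * z\<^sup>2"
    unfolding S2(1) d by (simp add: algebra_simps)
  ultimately show ?thesis
    using pos by (simp add: z_def[symmetric] c_def[symmetric] d_def[symmetric] power2_eq_square)
qed

text \<open>
  With \<open>p = 1/2 - a\<close> and \<open>q = 1/2 + a\<close> one has \<open>c\<^sup>2 = p q\<close> and
  \<open>d = q\<^sup>2 cos\<^sup>2 s + p\<^sup>2 sin\<^sup>2 s\<close>, so \<open>arctan ((p/q) tan s)\<close> is an antiderivative of \<open>c\<^sup>2 / d\<close>.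
  The function below is its continuation across the poles of the tangent.
\<close>

lemma comparison_angle_deriv:
  assumes "0 < a" "a < 1/2"
  shows "((\<lambda>s. s - arctan (a * sin (2 * s) / (z_fn a s)\<^sup>2)) has_real_derivative
      (c_fn a)\<^sup>2 / d_fn a s) (at s)"
proof -
  define Z where "Z = (z_fn a s)\<^sup>2"
  define d where "d = d_fn a s"
  define S where "S = a * sin (2 * s)"
  have pos: "Z > 0" "d > 0"
    using z_pos[OF assms, of s] d_pos[OF assms, of s]
    by (auto simp: Z_def d_def)
  have Zd: "1 + (S / Z)\<^sup>2 = d / Z\<^sup>2"
    using denominator_eq[OF assms, of s] pos
    by (simp add: Z_def S_def d_def field_simps)
  have C: "a * cos (2 * s) = Z - 1/2"
    by (simp add: Z_def z_squared[OF assms])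
  have S2: "S\<^sup>2 = (1 - Z) * Z - (c_fn a)\<^sup>2"
    using unit_speed[OF assms, of s] by (simp add: S_def Z_def lam_eq[OF assms] field_simps)
  have d: "d = Z - (c_fn a)\<^sup>2"
    by (simp add: d_def d_fn_def Z_def)
  have quotient: "((\<lambda>s. a * sin (2 * s) / (1/2 + a * cos (2 * s))) has_real_derivative
      (2 * (a * cos (2 * s)) * Z + 2 * S * S) / Z\<^sup>2) (at s)"
  proof -
    have "((\<lambda>s. a * sin (2 * s)) has_real_derivative 2 * (a * cos (2 * s))) (at s)"
      and "((\<lambda>s. 1/2 + a * cos (2 * s)) has_real_derivative - 2 * S) (at s)"
      by (auto intro!: derivative_eq_intros simp: S_def)
    from DERIV_divide[OF this] show ?thesis
      using pos C by (simp add: S_def power2_eq_square mult.assoc mult.left_commute)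
  qed
  have "((\<lambda>s. s - arctan (a * sin (2 * s) / (z_fn a s)\<^sup>2)) has_real_derivative
      1 - inverse (1 + (S / Z)\<^sup>2) * ((2 * (a * cos (2 * s)) * Z + 2 * S * S) / Z\<^sup>2)) (at s)"
    using DERIV_diff[OF DERIV_ident DERIV_chain2[OF DERIV_arctan quotient]]
    by (simp add: z_squared[OF assms] Z_def S_def)
  moreover have "1 - inverse (1 + (S / Z)\<^sup>2) * ((2 * (a * cos (2 * s)) * Z + 2 * S * S) / Z\<^sup>2)
     = (d - ((2 * Z - 1) * Z + 2 * S\<^sup>2)) / d"
    unfolding Zd C using pos by (simp add: field_simps power2_eq_square)
  moreover have "d - ((2 * Z - 1) * Z + 2 * S\<^sup>2) = (c_fn a)\<^sup>2"
    unfolding S2 d by (simp add: algebra_simps)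
  ultimately show ?thesis
    by (simp add: d_def)
qed

lemma phase_zero: "phase_fn a 0 = - pi / 2"
proof -
  have "beta_fn a 0 = 0"
    unfolding beta_fn_def zero_ereal_def by (rule interval_integral_endpoints_same)
  then show ?thesis
    by (simp add: phase_fn_def)
qed

lemma c_less_z:
  assumes "0 < a" "a < 1/2"
  shows "c_fn a < z_fn a s"
  by (rule power_less_imp_less_base[of _ 2])
     (use d_pos[OF assms, of s] z_pos[OF assms, of s] in \<open>auto simp: d_fn_def\<close>)

text \<open>
  From \<open>c < z\<close> and \<open>2 c z \<le> c\<^sup>2 + z\<^sup>2\<close> it follows that \<open>c\<^sup>2/d < c z / d \<le> c\<^sup>2/d + 1/2\<close>. The
  integral of \<open>c\<^sup>2/d\<close> over \<open>{0..\<pi>/2}\<close> is \<open>\<pi>/2\<close>, which compensates exactly for the initial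
  value \<open>-\<pi>/2\<close> of the phase.
\<close>

lemma phase_half_pi:
  assumes "0 < a" "a < 1/2"
  shows "0 < phase_fn a (pi / 2)" "phase_fn a (pi / 2) \<le> pi / 4"
proof -
  define \<psi> where "\<psi> = (\<lambda>s. s - arctan (a * sin (2 * s) / (z_fn a s)\<^sup>2))"
  note deriv = phase_deriv[OF assms] comparison_angle_deriv[OF assms, folded \<psi>_def]
  have \<psi>: "\<psi> 0 = 0" "\<psi> (pi / 2) = pi / 2"
    by (simp_all add: \<psi>_def)
  have "phase_fn a 0 - \<psi> 0 < phase_fn a (pi / 2) - \<psi> (pi / 2)"
  proof (rule DERIV_pos_imp_increasing[where f = "\<lambda>s. phase_fn a s - \<psi> s"])
    fix s :: real
    have "0 < c_fn a * (z_fn a s - c_fn a) / d_fn a s"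
      using c_pos[OF assms] c_less_z[OF assms, of s] d_pos[OF assms, of s]
      by (intro divide_pos_pos mult_pos_pos) auto
    also have "\<dots> = c_fn a * z_fn a s / d_fn a s - (c_fn a)\<^sup>2 / d_fn a s"
      by (simp add: power2_eq_square right_diff_distrib diff_divide_distrib)
    finally have "c_fn a * z_fn a s / d_fn a s - (c_fn a)\<^sup>2 / d_fn a s > 0" .
    then show "\<exists>y. ((\<lambda>s. phase_fn a s - \<psi> s) has_real_derivative y) (at s) \<and> 0 < y"
      by (blast intro: DERIV_diff deriv)
  qed simp
  then show "0 < phase_fn a (pi / 2)"
    unfolding phase_zero \<psi> by linarith
  have "phase_fn a (pi / 2) - \<psi> (pi / 2) - (pi / 2) / 2 \<le> phase_fn a 0 - \<psi> 0 - 0 / 2"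
  proof (rule DERIV_nonpos_imp_nonincreasing[where f = "\<lambda>s. phase_fn a s - \<psi> s - s / 2"])
    fix s :: real
    have "c_fn a * z_fn a s \<le> (c_fn a)\<^sup>2 + 1 / 2 * d_fn a s"
      using sum_squares_bound[of "c_fn a" "z_fn a s"] unfolding d_fn_def
      by (simp add: diff_divide_distrib)
    then have "c_fn a * z_fn a s / d_fn a s \<le> ((c_fn a)\<^sup>2 + 1 / 2 * d_fn a s) / d_fn a s"
      using d_pos[OF assms, of s] by (intro divide_right_mono) auto
    also have "\<dots> = (c_fn a)\<^sup>2 / d_fn a s + 1 / 2"
      using d_pos[OF assms, of s] by (simp add: add_divide_distrib)
    finally have "c_fn a * z_fn a s / d_fn a s - (c_fn a)\<^sup>2 / d_fn a s - 1 / 2 \<le> 0"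
      by linarith
    then show "\<exists>y. ((\<lambda>s. phase_fn a s - \<psi> s - s / 2) has_real_derivative y) (at s) \<and> y \<le> 0"
      using DERIV_diff[OF DERIV_diff[OF deriv, of s] DERIV_cdivide[OF DERIV_ident, of 2]] by blast
  qed simp
  then show "phase_fn a (pi / 2) \<le> pi / 4"
    unfolding phase_zero \<psi> by linarith
qed

section \<open>The first zero and the values there\<close>

lemma phase_strict_mono:
  assumes "0 < a" "a < 1/2" "s < t"
  shows "phase_fn a s < phase_fn a t"
proof (rule DERIV_pos_imp_increasing[OF assms(3)])
  fix u
  show "\<exists>y. (phase_fn a has_real_derivative y) (at u) \<and> 0 < y"
    using phase_deriv[OF assms(1,2), of u] c_pos[OF assms(1,2)] z_pos[OF assms(1,2), of u]
      d_pos[OF assms(1,2), of u] by (meson divide_pos_pos mult_pos_pos)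
qed

text \<open>On this interval the phase stays in \<open>]-\<pi>, \<pi>[\<close>, where the sine vanishes only at \<open>0\<close>.\<close>

lemma G_zero_iff:
  assumes "0 < a" "a < 1/2" "0 < s" "s \<le> pi / 2"
  shows "G_fn a s = 0 \<longleftrightarrow> phase_fn a s = 0"
proof -
  have "phase_fn a 0 < phase_fn a s"
    using phase_strict_mono[OF assms(1,2,3)] .
  moreover have "phase_fn a s \<le> phase_fn a (pi / 2)"
    using phase_strict_mono[OF assms(1,2), of s "pi / 2"] assms(4) by (metis le_less)
  ultimately have "\<bar>phase_fn a s\<bar> < pi"
    using phase_half_pi[OF assms(1,2)] by (auto simp: phase_zero abs_less_iff)
  then have "sin (phase_fn a s) = 0 \<longleftrightarrow> phase_fn a s = 0"
    using sin_eq_0_pi by (auto simp: abs_less_iff)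
  then show ?thesis
    using d_pos[OF assms(1,2), of s] z_pos[OF assms(1,2), of s]
    by (simp add: G_eq_sin_phase[OF assms(1,2)])
qed

lemma s1_zero_of_phase:
  assumes "0 < a" "a < 1/2"
  shows "0 < s1_fn a" "s1_fn a < pi / 2" "phase_fn a (s1_fn a) = 0"
proof -
  have "\<forall>s. isCont (phase_fn a) s"
    using phase_deriv[OF assms] DERIV_isCont by blast
  then obtain s where s: "0 \<le> s" "s \<le> pi / 2" "phase_fn a s = 0"
    using IVT[of "phase_fn a" 0 0 "pi/2"] phase_half_pi(1)[OF assms] phase_zero[of a] by auto
  have "s \<noteq> 0"
    using s(3) phase_zero[of a] by auto
  moreover have "s \<noteq> pi / 2"
    using s(3) phase_half_pi(1)[OF assms] by force
  ultimately have s': "0 < s" "s < pi / 2"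
    using s by linarith+
  have "s1_fn a = s"
    unfolding s1_fn_def
  proof (rule the_equality)
    show "0 < s \<and> s \<le> pi / 2 \<and> G_fn a s = 0"
      using s s' G_zero_iff[OF assms, of s] by blast
    fix t assume "0 < t \<and> t \<le> pi / 2 \<and> G_fn a t = 0"
    then have "phase_fn a t = phase_fn a s"
      using s G_zero_iff[OF assms, of t] by simp
    then show "t = s"
      using phase_strict_mono[OF assms, of s t] phase_strict_mono[OF assms, of t s] by linarith
  qed
  with s s' show "0 < s1_fn a" "s1_fn a < pi / 2" "phase_fn a (s1_fn a) = 0" by auto
qed

text \<open>
  A vanishing phase means \<open>\<beta> = \<pi>/2 + arctan (a sin 2s / (c z))\<close>, so \<open>sin \<beta>\<close> is the cosine of
  an arctangent; in particular it is positive.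
\<close>

lemma y_s1:
  assumes "0 < a" "a < 1/2"
  shows "y_fn a (s1_fn a) = c_fn a * z_fn a (s1_fn a) / sqrt (d_fn a (s1_fn a))"
proof -
  define s where "s = s1_fn a"
  have "beta_fn a s = pi / 2 + arctan (a * sin (2 * s) / (c_fn a * z_fn a s))"
    using s1_zero_of_phase(3)[OF assms] by (simp add: phase_fn_def s_def)
  then have "sin (beta_fn a s) = 1 / (sqrt (lam_fn a s) * sqrt (d_fn a s) / (c_fn a * z_fn a s))"
    by (simp add: sin_add cos_arctan sqrt_one_plus_square[OF assms])
  then show ?thesis
    using lam_pos[OF assms, of s] by (simp add: y_fn_def s_def)
qed

text \<open>
  The same value of \<open>\<beta>\<close> gives \<open>x = - a sin 2s / sqrt d\<close>. Since \<open>d\<close> is the sum of the squares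
  of \<open>z\<^sup>2\<close> and \<open>a sin 2s\<close>, this is the cosine of \<open>\<pi>/2 + arctan (a sin 2s / z\<^sup>2)\<close>, an angle in
  \<open>[0, \<pi>]\<close>, where \<open>arccos\<close> inverts the cosine.
\<close>

lemma R_eq_arctan:
  assumes "0 < a" "a < 1/2"
  shows "R_fn a = pi / 2 + arctan (a * sin (2 * s1_fn a) / (z_fn a (s1_fn a))\<^sup>2)"
proof -
  define s where "s = s1_fn a"
  define S where "S = a * sin (2 * s)"
  note pos = z_pos[OF assms, of s] d_pos[OF assms, of s] c_pos[OF assms] lam_pos[OF assms, of s]
  have "beta_fn a s = pi / 2 + arctan (S / (c_fn a * z_fn a s))"
    using s1_zero_of_phase(3)[OF assms] by (simp add: phase_fn_def s_def S_def)
  then have "cos (beta_fn a s) = - (S / (c_fn a * z_fn a s)) /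
      (sqrt (lam_fn a s) * sqrt (d_fn a s) / (c_fn a * z_fn a s))"
    by (simp add: cos_add sin_arctan sqrt_one_plus_square[OF assms] S_def)
  then have x: "x_fn a s = - S / sqrt (d_fn a s)"
    using pos by (simp add: x_fn_def)
  have "1 + (S / (z_fn a s)\<^sup>2)\<^sup>2 = d_fn a s / ((z_fn a s)\<^sup>2)\<^sup>2"
    using denominator_eq[OF assms, of s] pos by (simp add: S_def field_simps)
  then have "sqrt (1 + (S / (z_fn a s)\<^sup>2)\<^sup>2) = sqrt (d_fn a s) / (z_fn a s)\<^sup>2"
    by (simp only: real_sqrt_divide real_sqrt_abs) simp
  then have "cos (pi / 2 + arctan (S / (z_fn a s)\<^sup>2)) = x_fn a s"
    unfolding x using pos by (simp add: cos_add sin_arctan)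
  moreover have "0 \<le> pi / 2 + arctan (S / (z_fn a s)\<^sup>2)" "pi / 2 + arctan (S / (z_fn a s)\<^sup>2) \<le> pi"
    using arctan_bounded[of "S / (z_fn a s)\<^sup>2"] by auto
  ultimately show ?thesis
    using arccos_cos by (metis R_fn_def S_def s_def)
qed

section \<open>Dependence on the parameter\<close>

definition omega_param_deriv :: "real \<Rightarrow> real \<Rightarrow> real" where
  "omega_param_deriv b t =
     - b / (c_fn b * z_fn b t * lam_fn b t)
     - c_fn b * cos (2 * t) / (2 * z_fn b t ^ 3 * lam_fn b t)
     + c_fn b * cos (2 * t) / (z_fn b t * (lam_fn b t)\<^sup>2)"

lemma c_param_deriv:
  assumes "0 < a" "a < 1/2"
  shows "(c_fn has_real_derivative - a / c_fn a) (at a)"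
  using quarter_minus_square_pos[OF assms] unfolding c_fn_def
  by (auto intro!: derivative_eq_intros simp: field_simps)

lemma z_param_deriv:
  assumes "0 < a" "a < 1/2"
  shows "((\<lambda>b. z_fn b s) has_real_derivative cos (2 * s) / (2 * z_fn a s)) (at a)"
  using radicand_pos[OF assms, of s] unfolding z_fn_def
  by (auto intro!: derivative_eq_intros simp: field_simps)

lemma omega_param:
  assumes "0 < a" "a < 1/2"
  shows "((\<lambda>b. omega_fn b t) has_real_derivative omega_param_deriv a t) (at a)"
proof -
  define z where "z = z_fn a t"
  define c where "c = c_fn a"
  define l where "l = lam_fn a t"
  define C where "C = cos (2 * t)"
  have pos: "c > 0" "z > 0" "l > 0"
    using c_pos[OF assms] z_pos[OF assms] lam_pos[OF assms] by (simp_all add: z_def c_def l_def)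
  have "((\<lambda>b. lam_fn b t) has_real_derivative - C) (at a)"
    unfolding lam_fn_def C_def by (auto intro!: derivative_eq_intros)
  from DERIV_divide[OF c_param_deriv[OF assms] DERIV_mult[OF z_param_deriv[OF assms, of t] this]]
  have "((\<lambda>b. omega_fn b t) has_real_derivative
      (- a / c * (z * l) - c * (C / (2 * z) * l + - C * z)) / (z * l * (z * l))) (at a)"
    using pos by (simp add: omega_fn_def z_def c_def l_def C_def)
  moreover have "(- a / c * (z * l) - c * (C / (2 * z) * l + - C * z)) / (z * l * (z * l))
      = - a / (c * z * l) - c * C / (2 * z ^ 3 * l) + c * C / (z * l\<^sup>2)"
    using pos by (simp add: field_simps power2_eq_square power3_eq_cube)
  ultimately show ?thesis
    by (simp only: omega_param_deriv_def z_def c_def l_def C_def)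
qed

text \<open>
  Differentiation under the integral sign, for which the parameter derivative of the
  integrand must be jointly continuous. The value of the derivative is an integral without
  an elementary form; it enters the final formulas only through the derivative of \<open>G_fn\<close>.
\<close>

lemma beta_differentiable_param:
  assumes "0 < a" "a < 1/2" "0 \<le> s"
  shows "\<exists>d. ((\<lambda>b. beta_fn b s) has_real_derivative d) (at a)"
proof -
  define U where "U = {0<..<1/2::real}"
  have U: "a \<in> U" "convex U" "open U" using assms by (auto simp: U_def)
  have cont: "continuous_on {0..s} (omega_fn b)" if "b \<in> U" for b
    using z_pos[of b] lam_pos[of b] that
    unfolding omega_fn_def z_fn_def lam_fn_def U_def
    by (intro continuous_intros) (auto simp: less_imp_neq[symmetric])
  have cont_c: "continuous_on (U \<times> cbox 0 s) (\<lambda>p. c_fn (fst p))"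
    unfolding c_fn_def by (intro continuous_intros)
  have cont_z: "continuous_on (U \<times> cbox 0 s) (\<lambda>p. z_fn (fst p) (snd p))"
    unfolding z_fn_def by (intro continuous_intros)
  have cont_lam: "continuous_on (U \<times> cbox 0 s) (\<lambda>p. lam_fn (fst p) (snd p))"
    unfolding lam_fn_def by (intro continuous_intros)
  have nonzero: "c_fn (fst p) \<noteq> 0" "z_fn (fst p) (snd p) \<noteq> 0" "lam_fn (fst p) (snd p) \<noteq> 0"
    if "p \<in> U \<times> cbox 0 s" for p
  proof -
    have "0 < fst p" "fst p < 1/2"
      using that by (auto simp: U_def)
    then show "c_fn (fst p) \<noteq> 0" "z_fn (fst p) (snd p) \<noteq> 0" "lam_fn (fst p) (snd p) \<noteq> 0"
      using c_pos z_pos lam_pos by (simp_all add: less_imp_neq[symmetric])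
  qed
  have cont_deriv: "continuous_on (U \<times> cbox 0 s) (\<lambda>(b, t). omega_param_deriv b t)"
    unfolding omega_param_deriv_def split_beta
    by (intro continuous_on_add continuous_on_diff continuous_on_divide continuous_on_mult
          continuous_on_minus continuous_on_power continuous_on_cos continuous_on_const
          continuous_on_fst continuous_on_snd continuous_on_id cont_c cont_z cont_lam ballI)
       (simp_all only: nonzero mult_eq_0_iff power_eq_0_iff simp_thms zero_neq_numeral)
  have "((\<lambda>b. integral (cbox 0 s) (omega_fn b)) has_real_derivative
      integral (cbox 0 s) (omega_param_deriv a)) (at a within U)"
  proof (rule leibniz_rule_field_derivative[where f = omega_fn and fx = omega_param_deriv])
    show "((\<lambda>b. omega_fn b t) has_real_derivative omega_param_deriv b t) (at b within U)"
      if "b \<in> U" for b t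
      by (rule has_field_derivative_at_within, rule omega_param) (use that in \<open>simp_all add: U_def\<close>)
    show "omega_fn b integrable_on cbox 0 s" if "b \<in> U" for b
      using cont[OF that] by (simp add: integrable_continuous_real)
  qed (use cont_deriv U in auto)
  then have "((\<lambda>b. integral {0..s} (omega_fn b)) has_real_derivative
      integral (cbox 0 s) (omega_param_deriv a)) (at a)"
    using at_within_open[OF U(1,3)] by simp
  moreover have eq: "beta_fn b s = integral {0..s} (omega_fn b)" if "b \<in> U" for b
    unfolding beta_fn_def zero_ereal_def
    by (rule interval_integral_eq_integral[OF assms(3)], unfold set_integrable_def,
        rule borel_integrable_compact[OF compact_Icc cont[OF that]])
  moreover have "\<forall>\<^sub>F b in nhds a. beta_fn b s = integral {0..s} (omega_fn b)"
    using eventually_nhds_in_open[OF U(3,1)] by (rule eventually_mono) (fact eq)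
  ultimately have "((\<lambda>b. beta_fn b s) has_real_derivative
      integral (cbox 0 s) (omega_param_deriv a)) (at a)"
    by (simp only: DERIV_cong_ev[OF refl _ refl])
  then show ?thesis ..
qed

lemma phase_differentiable_param:
  assumes "0 < a" "a < 1/2" "0 \<le> s"
  shows "\<exists>d. ((\<lambda>b. phase_fn b s) has_real_derivative d) (at a)"
proof -
  obtain d where d: "((\<lambda>b. beta_fn b s) has_real_derivative d) (at a)"
    using beta_differentiable_param[OF assms] by blast
  have "((\<lambda>b. c_fn b * z_fn b s) has_real_derivative
      - a / c_fn a * z_fn a s + cos (2 * s) / (2 * z_fn a s) * c_fn a) (at a)"
    by (rule DERIV_mult[OF c_param_deriv z_param_deriv]) (use assms in auto)
  moreover have "((\<lambda>b. b * sin (2 * s)) has_real_derivative sin (2 * s)) (at a)"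
    by (auto intro!: derivative_eq_intros)
  moreover have "c_fn a * z_fn a s \<noteq> 0"
    using c_pos[OF assms(1,2)] z_pos[OF assms(1,2), of s] by simp
  ultimately obtain e where "((\<lambda>b. b * sin (2 * s) / (c_fn b * z_fn b s)) has_real_derivative e) (at a)"
    using DERIV_divide by blast
  from DERIV_chain2[OF DERIV_arctan this]
  have "((\<lambda>b. phase_fn b s) has_real_derivative
      d - 0 - inverse (1 + (a * sin (2 * s) / (c_fn a * z_fn a s))\<^sup>2) * e) (at a)"
    unfolding phase_fn_def by (intro DERIV_diff d DERIV_const)
  then show ?thesis ..
qed

text \<open>
  A lower bound on the slope of the phase that is uniform in \<open>s\<close>: it controls how far the zero
  can move when the parameter changes.
\<close>

lemma phase_deriv_lower:
  assumes "0 < a" "a < 1/2"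
  shows "(c_fn a)\<^sup>2 \<le> c_fn a * z_fn a s / d_fn a s"
proof -
  have "d_fn a s \<le> 1"
    using lam_pos[OF assms, of s] lam_eq[OF assms, of s]
    by (simp add: d_fn_def) (smt (verit) zero_le_power2)
  then have "(c_fn a)\<^sup>2 * d_fn a s \<le> (c_fn a)\<^sup>2 * 1"
    by (intro mult_left_mono) auto
  also have "\<dots> \<le> c_fn a * z_fn a s"
    using c_less_z[OF assms, of s] c_pos[OF assms] by (simp add: power2_eq_square)
  finally show ?thesis
    using d_pos[OF assms, of s] by (simp add: field_simps)
qed

lemma phase_mean_value:
  assumes "0 < a" "a < 1/2"
  shows "\<exists>\<xi>. \<bar>\<xi> - s\<bar> \<le> \<bar>t - s\<bar> \<and> phase_fn a t - phase_fn a s = (t - s) * (c_fn a * z_fn a \<xi> / d_fn a \<xi>)"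
proof -
  have mv: "\<exists>\<xi>. u < \<xi> \<and> \<xi> < v \<and> phase_fn a v - phase_fn a u = (v - u) * (c_fn a * z_fn a \<xi> / d_fn a \<xi>)"
    if "u < v" for u v
    using MVT2[OF that phase_deriv[OF assms]] by blast
  consider "s < t" | "t < s" | "s = t" by linarith
  then show ?thesis
  proof cases
    case 1
    then obtain \<xi> where "s < \<xi>" "\<xi> < t"
      "phase_fn a t - phase_fn a s = (t - s) * (c_fn a * z_fn a \<xi> / d_fn a \<xi>)"
      using mv by blast
    then show ?thesis by (intro exI[of _ \<xi>]) auto
  next
    case 2
    then obtain \<xi> where "t < \<xi>" "\<xi> < s"
      "phase_fn a s - phase_fn a t = (s - t) * (c_fn a * z_fn a \<xi> / d_fn a \<xi>)"
      using mv by blast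
    moreover from this(3) have
      "phase_fn a t - phase_fn a s = (t - s) * (c_fn a * z_fn a \<xi> / d_fn a \<xi>)"
      by (simp only: left_diff_distrib)
    ultimately show ?thesis by (intro exI[of _ \<xi>]) auto
  qed auto
qed

text \<open>
  Implicit differentiation from separate derivatives only. At the old zero \<open>s\<close>, the mean value
  theorem for the phase with the new parameter \<open>b\<close> reads
  \<open>- \<Phi>\<^sub>b s = (s1 b - s) \<Phi>\<^sub>b' \<xi>\<close> with \<open>\<xi>\<close> between \<open>s\<close> and \<open>s1 b\<close>. By the lower bound
  on the slope, \<open>\<xi>\<close> tends to \<open>s\<close> as \<open>b\<close> tends to \<open>a\<close>; the slope is jointly continuous, so
  dividing by \<open>b - a\<close> and passing to the limit gives the derivative.
\<close>

lemma s1_deriv: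
  assumes "0 < a" "a < 1/2"
  assumes d: "((\<lambda>b. phase_fn b (s1_fn a)) has_real_derivative d) (at a)"
  shows "(s1_fn has_real_derivative - d / (c_fn a * z_fn a (s1_fn a) / d_fn a (s1_fn a))) (at a)"
proof -
  define s where "s = s1_fn a"
  define g where "g b t = c_fn b * z_fn b t / d_fn b t" for b t
  have near: "\<forall>\<^sub>F b in at a. 0 < b \<and> b < 1/2"
    using eventually_at_in_open'[of "{0<..<1/2}" a] assms(1,2) by simp
  have d0: "((\<lambda>b. phase_fn b s) \<longlongrightarrow> 0) (at a)"
    using DERIV_isCont[OF d] s1_zero_of_phase(3)[OF assms(1,2)] by (simp add: s_def isCont_def)
  have c_lim: "(c_fn \<longlongrightarrow> c_fn a) (at a)"
    using DERIV_isCont[OF c_param_deriv[OF assms(1,2)]] by (simp add: isCont_def)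
  have "\<exists>\<xi>. \<bar>\<xi> - s\<bar> \<le> \<bar>s1_fn b - s\<bar> \<and> - phase_fn b s = (s1_fn b - s) * g b \<xi>"
    if "0 < b" "b < 1/2" for b
    using phase_mean_value[OF that, of s "s1_fn b"] s1_zero_of_phase(3)[OF that] by (simp add: g_def)
  then obtain \<xi> where \<xi>: "\<And>b. 0 < b \<Longrightarrow> b < 1/2 \<Longrightarrow> \<bar>\<xi> b - s\<bar> \<le> \<bar>s1_fn b - s\<bar>"
      "\<And>b. 0 < b \<Longrightarrow> b < 1/2 \<Longrightarrow> - phase_fn b s = (s1_fn b - s) * g b (\<xi> b)"
    by metis
  have "\<bar>\<xi> b - s\<bar> \<le> \<bar>phase_fn b s\<bar> / (c_fn b)\<^sup>2" if b: "0 < b" "b < 1/2" for b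
  proof -
    have "\<bar>s1_fn b - s\<bar> * (c_fn b)\<^sup>2 \<le> \<bar>s1_fn b - s\<bar> * \<bar>g b (\<xi> b)\<bar>"
      using order_trans[OF phase_deriv_lower[OF b, of "\<xi> b"] abs_ge_self]
      by (intro mult_left_mono) (simp_all add: g_def)
    also have "\<dots> = \<bar>phase_fn b s\<bar>"
      using \<xi>(2)[OF b] by (metis abs_minus_cancel abs_mult)
    finally have "\<bar>s1_fn b - s\<bar> \<le> \<bar>phase_fn b s\<bar> / (c_fn b)\<^sup>2"
      using c_pos[OF b] by (simp add: field_simps)
    with \<xi>(1)[OF b] show ?thesis by linarith
  qed
  then have "\<forall>\<^sub>F b in at a. norm (\<xi> b - s) \<le> \<bar>phase_fn b s\<bar> / (c_fn b)\<^sup>2"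
    using near by (auto elim: eventually_mono)
  moreover have "((\<lambda>b. \<bar>phase_fn b s\<bar> / (c_fn b)\<^sup>2) \<longlongrightarrow> \<bar>0\<bar> / (c_fn a)\<^sup>2) (at a)"
    using c_pos[OF assms(1,2)] by (intro tendsto_intros d0 c_lim) auto
  ultimately have "((\<lambda>b. \<xi> b - s) \<longlongrightarrow> 0) (at a)"
    by (simp add: Lim_null_comparison)
  then have \<xi>_lim: "(\<xi> \<longlongrightarrow> s) (at a)"
    by (simp add: LIM_zero_iff)
  have z_lim: "((\<lambda>b. z_fn b (\<xi> b)) \<longlongrightarrow> z_fn a s) (at a)"
    unfolding z_fn_def by (intro tendsto_intros \<xi>_lim)
  have g_lim: "((\<lambda>b. g b (\<xi> b)) \<longlongrightarrow> g a s) (at a)"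
    using d_pos[OF assms(1,2), of s] unfolding g_def d_fn_def
    by (intro tendsto_intros z_lim c_lim) auto
  have g_pos: "g b t > 0" if "0 < b" "b < 1/2" for b t
    using c_pos[OF that] z_pos[OF that] d_pos[OF that] by (simp add: g_def)
  have "((\<lambda>b. phase_fn b s / (b - a)) \<longlongrightarrow> d) (at a)"
    using d s1_zero_of_phase(3)[OF assms(1,2)] by (simp add: has_field_derivative_iff s_def)
  then have "((\<lambda>b. - (phase_fn b s / (b - a)) / g b (\<xi> b)) \<longlongrightarrow> - d / g a s) (at a)"
    using g_pos[OF assms(1,2), of s] by (intro tendsto_intros g_lim) auto
  moreover have "\<forall>\<^sub>F b in at a. - (phase_fn b s / (b - a)) / g b (\<xi> b) = (s1_fn b - s1_fn a) / (b - a)"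
    using near
  proof eventually_elim
    case (elim b)
    have "- (phase_fn b s / (b - a)) / g b (\<xi> b) = - phase_fn b s / g b (\<xi> b) / (b - a)"
      by simp
    also have "\<dots> = (s1_fn b - s) / (b - a)"
      using \<xi>(2)[of b] g_pos[of b "\<xi> b"] elim by simp
    finally show ?case
      by (simp add: s_def)
  qed
  ultimately show ?thesis
    unfolding has_field_derivative_iff g_def s_def by (rule Lim_transform_eventually)
qed

text \<open>
  In the product rule for \<open>sqrt d / z\<close> times \<open>sin \<Phi>\<close>, the derivative of the first factor is
  multiplied by \<open>sin 0\<close> and the second factor contributes \<open>cos 0 = 1\<close>.
\<close>

lemma G_param_deriv_at_s1:
  assumes "0 < a" "a < 1/2"
  assumes d: "((\<lambda>b. phase_fn b (s1_fn a)) has_real_derivative d) (at a)"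
  shows "((\<lambda>b. G_fn b (s1_fn a)) has_real_derivative
    sqrt (d_fn a (s1_fn a)) / z_fn a (s1_fn a) * d) (at a)"
proof -
  define s where "s = s1_fn a"
  have zero: "phase_fn a s = 0"
    using s1_zero_of_phase(3)[OF assms(1,2)] by (simp add: s_def)
  have zd: "((\<lambda>b. (z_fn b s)\<^sup>2 - (c_fn b)\<^sup>2) has_real_derivative
      2 * z_fn a s * (cos (2 * s) / (2 * z_fn a s)) - 2 * c_fn a * (- a / c_fn a)) (at a)"
    by (auto intro!: derivative_eq_intros z_param_deriv c_param_deriv assms)
  obtain e where e: "((\<lambda>b. sqrt (d_fn b s) / z_fn b s) has_real_derivative e) (at a)"
    using DERIV_divide[OF DERIV_chain2[OF DERIV_real_sqrt zd] z_param_deriv[OF assms(1,2), of s]]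
      d_pos[OF assms(1,2), of s] z_pos[OF assms(1,2), of s] by (auto simp: d_fn_def)
  have "((\<lambda>b. sin (phase_fn b s)) has_real_derivative d) (at a)"
    using DERIV_chain2[OF DERIV_sin d[folded s_def]] zero by simp
  from DERIV_mult[OF e this]
  have "((\<lambda>b. sqrt (d_fn b s) / z_fn b s * sin (phase_fn b s)) has_real_derivative
      sqrt (d_fn a s) / z_fn a s * d) (at a)"
    by (simp add: zero mult.commute)
  moreover have "\<forall>\<^sub>F b in nhds a. G_fn b s = sqrt (d_fn b s) / z_fn b s * sin (phase_fn b s)"
    by (rule eventually_mono[OF eventually_nhds_in_open[of "{0<..<1/2}"]])
       (use assms(1,2) in \<open>simp_all add: G_eq_sin_phase\<close>)
  ultimately have "((\<lambda>b. G_fn b s) has_real_derivative sqrt (d_fn a s) / z_fn a s * d) (at a)"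
    by (simp only: DERIV_cong_ev[OF refl _ refl])
  then show ?thesis
    unfolding s_def .
qed

text \<open>
  Differentiating the arctangent formula for \<open>R\<close>: the coefficient of \<open>sin (2s)\<close> in the numerator
  is \<open>z\<^sup>2 - a cos 2s\<close>, which is \<open>1/2\<close>.
\<close>

lemma R_deriv:
  assumes "0 < a" "a < 1/2"
  assumes s1': "(s1_fn has_real_derivative s') (at a)"
  defines "s \<equiv> s1_fn a"
  shows "(R_fn has_real_derivative
    (1/2 * sin (2 * s) + 2 * a * ((z_fn a s)\<^sup>2 * cos (2 * s) + a * (sin (2 * s))\<^sup>2) * s') / d_fn a s) (at a)"
proof -
  define Z where "Z = (z_fn a s)\<^sup>2"
  define S where "S = sin (2 * s)"
  define C where "C = cos (2 * s)"
  have pos: "Z > 0" "d_fn a s > 0"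
    using z_pos[OF assms(1,2), of s] d_pos[OF assms(1,2), of s] by (auto simp: Z_def)
  have Z: "1/2 + a * C = Z"
    by (simp add: Z_def z_squared[OF assms(1,2)] C_def)
  have root: "1 + (a * S / Z)\<^sup>2 = d_fn a s / Z\<^sup>2"
    using denominator_eq[OF assms(1,2), of s] pos by (simp add: Z_def S_def field_simps)
  have "((\<lambda>b. b * sin (2 * s1_fn b)) has_real_derivative S + 2 * a * C * s') (at a)"
    and "((\<lambda>b. 1/2 + b * cos (2 * s1_fn b)) has_real_derivative C - 2 * a * S * s') (at a)"
    by (auto intro!: derivative_eq_intros s1' simp: S_def C_def s_def)
  from DERIV_divide[OF this]
  have "((\<lambda>b. b * sin (2 * s1_fn b) / (1/2 + b * cos (2 * s1_fn b))) has_real_derivative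
      ((S + 2 * a * C * s') * Z - a * S * (C - 2 * a * S * s')) / (Z * Z)) (at a)"
    using pos Z by (simp add: S_def C_def s_def)
  from DERIV_add[OF DERIV_const[of "pi / 2"] DERIV_chain2[OF DERIV_arctan this]]
  have "((\<lambda>b. pi / 2 + arctan (b * sin (2 * s1_fn b) / (1/2 + b * cos (2 * s1_fn b)))) has_real_derivative
      inverse (1 + (a * S / Z)\<^sup>2) *
        (((S + 2 * a * C * s') * Z - a * S * (C - 2 * a * S * s')) / (Z * Z))) (at a)"
    using Z by (simp add: S_def C_def s_def)
  moreover have "inverse (1 + (a * S / Z)\<^sup>2) *
        (((S + 2 * a * C * s') * Z - a * S * (C - 2 * a * S * s')) / (Z * Z))
      = ((Z - a * C) * S + 2 * a * (Z * C + a * S\<^sup>2) * s') / d_fn a s"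
    unfolding root using pos by (simp add: field_simps power2_eq_square)
  moreover have "Z - a * C = 1/2"
    using Z by simp
  ultimately have "((\<lambda>b. pi / 2 + arctan (b * sin (2 * s1_fn b) / (1/2 + b * cos (2 * s1_fn b))))
      has_real_derivative (1/2 * S + 2 * a * (Z * C + a * S\<^sup>2) * s') / d_fn a s) (at a)"
    by (simp only:)
  moreover have "\<forall>\<^sub>F b in nhds a. R_fn b =
      pi / 2 + arctan (b * sin (2 * s1_fn b) / (1/2 + b * cos (2 * s1_fn b)))"
    by (rule eventually_mono[OF eventually_nhds_in_open[of "{0<..<1/2}"]])
       (use assms(1,2) in \<open>simp_all add: R_eq_arctan z_squared\<close>)
  ultimately have "(R_fn has_real_derivative
      (1/2 * S + 2 * a * (Z * C + a * S\<^sup>2) * s') / d_fn a s) (at a)"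
    by (simp only: DERIV_cong_ev[OF refl _ refl])
  then show ?thesis
    unfolding Z_def S_def C_def .
qed

theorem proposition5p10:
  fixes a :: real
  assumes "0 < a" and "a < 1/2"
  shows "let s1 = s1_fn a;
             s1' = deriv s1_fn a;
             z = z_fn a s1;
             N = 1/2 * sin (2 * s1) + 2 * a * (z\<^sup>2 * cos (2 * s1) + a * (sin (2 * s1))\<^sup>2) * s1';
             D = z ^ 4 + a\<^sup>2 * (sin (2 * s1))\<^sup>2
         in (R_fn has_real_derivative N / D) (at a) \<and>
            D > 0 \<and>
            y_fn a s1 \<noteq> 0 \<and>
            (\<lambda>b. G_fn b s1) differentiable (at a) \<and>
            (s1_fn has_real_derivative
               - (z_fn a s1 / y_fn a s1) * deriv (\<lambda>b. G_fn b s1) a) (at a) \<and>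
            ((R_fn has_real_derivative 0) (at a) \<longleftrightarrow> N = 0)"
proof -
  define s where "s = s1_fn a"
  define N where "N = 1/2 * sin (2 * s) +
    2 * a * ((z_fn a s)\<^sup>2 * cos (2 * s) + a * (sin (2 * s))\<^sup>2) * deriv s1_fn a"
  note pos = z_pos[OF assms, of s] c_pos[OF assms] d_pos[OF assms, of s]
  have y: "y_fn a s = c_fn a * z_fn a s / sqrt (d_fn a s)"
    using y_s1[OF assms] by (simp add: s_def)
  obtain d where d: "((\<lambda>b. phase_fn b s) has_real_derivative d) (at a)"
    using phase_differentiable_param[OF assms] s1_zero_of_phase(1)[OF assms] by (force simp: s_def)
  have G: "((\<lambda>b. G_fn b s) has_real_derivative sqrt (d_fn a s) / z_fn a s * d) (at a)"
    using G_param_deriv_at_s1[OF assms d[unfolded s_def]] by (simp add: s_def)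
  have "- d / (c_fn a * z_fn a s / d_fn a s) = - (z_fn a s / y_fn a s) * deriv (\<lambda>b. G_fn b s) a"
    unfolding DERIV_imp_deriv[OF G] y using pos by (simp add: field_simps)
  then have s1': "(s1_fn has_real_derivative - (z_fn a s / y_fn a s) * deriv (\<lambda>b. G_fn b s) a) (at a)"
    using s1_deriv[OF assms d[unfolded s_def]] by (simp add: s_def)
  then have R: "(R_fn has_real_derivative N / d_fn a s) (at a)"
    using R_deriv[OF assms, of "deriv s1_fn a"] DERIV_imp_deriv[OF s1'] by (simp add: N_def s_def)
  then have "(R_fn has_real_derivative 0) (at a) \<longleftrightarrow> N = 0"
    using pos DERIV_unique[OF R, of 0] by auto
  moreover have "y_fn a s \<noteq> 0"
    using y pos by simp
  moreover have "(\<lambda>b. G_fn b s) differentiable (at a)"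
    using G real_differentiable_def by blast
  ultimately show ?thesis
    using R pos s1' unfolding Let_def s_def[symmetric] N_def[symmetric] denominator_eq[OF assms]
    by blast
qed

end
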